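(* Let $p$ be a Mersenne prime. Then the number of primitive elements $\xi$ in $\mathbb{F}_{p^4}$ satisfying $\operatorname{Tr}_{\mathbb{F}_{p^4}/\mathbb{F}_p}(\xi) = 0$ is $$\frac{1}{p}\left(\phi\left( p^4-1 \right) - \phi \left( \frac{p^4-1}{p+1} \right) \right).$$
   Context: $\phi$ is Euler's function. A primitive element of $\mathbb{F}_{p^4}$ is a generator of the multiplicative group $\mathbb{F}_{p^4}^*$. A Mersenne prime is a prime of the form $2^\ell - 1$ with $\ell$ prime. *)

theory Defs
  imports "HOL-Algebra.Multiplicative_Group" "HOL-Algebra.Generated_Groups" "HOL-Number_Theory.Totient"
begin

definition mersenne_prime :: "nat \<Rightarrow> bool" where
  "mersenne_prime p \<longleftrightarrow> prime p \<and> (\<exists>l::nat. prime l \<and> p = 2 ^ l - 1)"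

definition primitive_element :: "('a, 'b) ring_scheme \<Rightarrow> 'a \<Rightarrow> bool" where
  "primitive_element F \<xi> \<longleftrightarrow>
     \<xi> \<in> carrier (mult_of F) \<and> generate (mult_of F) {\<xi>} = carrier (mult_of F)"

text \<open>
  The trace from a field \<open>F\<close> with \<open>q ^ m\<close> elements to its subfield with \<open>q\<close> elements, i.e. the
  sum of the conjugates $\xi, \xi^q, \dots, \xi^{q^{m-1}}$. The value is taken in \<open>F\<close>, in which the
  subfield lies.
\<close>
definition finite_field_trace :: "('a, 'b) ring_scheme \<Rightarrow> nat \<Rightarrow> nat \<Rightarrow> 'a \<Rightarrow> 'a" where
  "finite_field_trace F q m \<xi> = (\<Oplus>\<^bsub>F\<^esub>i\<in>{..<m}. \<xi> [^]\<^bsub>F\<^esub> (q ^ i))"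

end

theory Submission
  imports Defs
begin

text \<open>
  Put $n = p^4 - 1$, $m = 2(p+1)$ and let $N$ be the number of primitive elements of trace zero.
  As $p + 1 = 2^l$, the number $m$ is a power of two, and $n = mr$ where
  $r = \frac{p-1}{2}(p^2+1)$ is even. Hence every prime divisor of $n$ divides $r$.
  
  This has two consequences. First, $n/(p+1) = 2r$ is even, so $\phi(n) = (p+1)\,\phi(n/(p+1))$,
  and the claimed value equals $\phi(n)/(p+1)$. Second, the group $C$ of $m$-th roots of unity acts
  on the primitive elements by multiplication (\<open>generator_mult_root_of_unity\<close>): relative to a
  primitive $\xi$, an element of $C$ is $\xi^k$ with $r \mid k$, and $k + 1$ is then coprime to $n$.
  
  Fix a primitive $\xi$ and ask for which $c \in C$ the product $c\xi$ has trace zero. As $m$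
  divides $p^2 - 1$, every $c \in C$ satisfies $c^{p^2} = c$, so
  $\mathrm{Tr}(c\xi) = cT + c^pT^p$ with $T = \xi + \xi^{p^2}$, the trace of $\xi$ to the subfield
  with $p^2$ elements. Here $T \neq 0$, since $\xi^{p^2-1} = -1$ would contradict primitivity. The
  condition becomes $c^{p-1} = u$ with $u = -T/T^p$, and $u^{p+1} = 1$ because $T^{p^2} = T$. As
  $C$ is cyclic of order $m = 2(p+1)$ and $\gcd(p-1,m) = 2$, exactly two $c \in C$ solve it
  (\<open>card_twists_trace_zero\<close>).
  
  Counting the pairs $(c,\xi)$ with $\mathrm{Tr}(c\xi) = 0$ in both orders
  (\<open>card_translates_double_count\<close>) gives $mN = 2\,\phi(n)$, that is $N = \phi(n)/(p+1)$.
\<close>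

section \<open>Roots of unity in finite cyclic groups\<close>

lemma (in group) generator_powers:
  assumes "finite (carrier G)" "g \<in> carrier G" "ord g = order G" "x \<in> carrier G"
  obtains k :: nat where "x = g [^] k"
proof -
  have "generate G {g} = carrier G"
    using assms generate_pow_card[of g] generate_is_subgroup[of "{g}"]
    by (intro card_subset_eq) (auto simp: order_def subgroup.subset)
  then show ?thesis
    using that generate_pow_on_finite_carrier[OF assms(1,2)] assms(4) by auto
qed

text \<open>
  Multiplying a generator $x$ by $c = x^k$ gives $x^{k+1}$. The condition $c^m = 1$ forces
  $|G|/m$ to divide $k$, so if $|G|/m$ has all the prime divisors of $|G|$, then $k + 1$ is coprime
  to $|G|$.
\<close>
lemma (in comm_group) generator_mult_root_of_unity:
  assumes fin: "finite (carrier G)" and x: "x \<in> carrier G" "ord x = order G"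
    and c: "c \<in> carrier G" "c [^] m = \<one>" and m: "m dvd order G"
    and primes: "\<And>q. prime q \<Longrightarrow> q dvd order G \<Longrightarrow> q dvd order G div m"
  shows "ord (c \<otimes> x) = order G"
proof -
  obtain k :: nat where k: "c = x [^] k"
    using generator_powers[OF fin x c(1)] .
  have pos: "order G > 0"
    using fin order_gt_0_iff_finite by blast
  have "order G dvd k * m"
    using c k x by (simp add: nat_pow_pow pow_eq_id)
  with m pos have dvd: "order G div m dvd k"
    by (auto elim!: dvdE)
  have "coprime (k + 1) (order G)"
  proof (rule ccontr)
    assume "\<not> ?thesis"
    then obtain q where q: "prime q" "q dvd gcd (k + 1) (order G)"
      using prime_factor_nat coprime_iff_gcd_eq_1 by blast
    then have "q dvd k"
      using primes[of q] dvd by (meson dvd_trans gcd_dvd2)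
    then have "q dvd 1"
      using q by (metis dvd_add_right_iff gcd_dvd1 dvd_trans)
    with q show False by simp
  qed
  moreover have "c \<otimes> x = x [^] (k + 1)"
    using k x by simp
  ultimately show ?thesis
    using pow_ord_eq_ord_iff[OF fin x(1)] x(2) by metis
qed

lemma (in group) card_roots_of_unity:
  assumes fin: "finite (carrier G)" and g: "g \<in> carrier G" "ord g = order G"
    and m: "m dvd order G"
  shows "card {x \<in> carrier G. x [^] m = \<one>} = m"
proof -
  have pos: "order G > 0"
    using fin order_gt_0_iff_finite by blast
  obtain e where e: "order G = m * e" using m by blast
  have ez: "e > 0" "m > 0" using pos e by auto
  have z: "g [^] e \<in> carrier G" "ord (g [^] e) = m"
    using g e ez by (auto simp: ord_pow_gen)
  have "{x \<in> carrier G. x [^] m = \<one>} = (\<lambda>i. (g [^] e) [^] i) ` {0 .. m - 1}" (is "?L = ?R")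
  proof
    show "?L \<subseteq> ?R"
    proof
      fix x assume "x \<in> ?L"
      then have x: "x \<in> carrier G" "x [^] m = \<one>" by auto
      obtain k :: nat where k: "x = g [^] k"
        using generator_powers[OF fin g x(1)] .
      have "m * e dvd k * m"
        using x k g e by (simp add: nat_pow_pow pow_eq_id)
      then obtain i where "k = e * i" using ez by auto
      then have "x \<in> {(g [^] e) [^] i | i. i \<in> (UNIV :: nat set)}"
        using k g by (auto simp: nat_pow_pow)
      then show "x \<in> ?R"
        unfolding ord_elems[OF fin z(1)] z(2) by blast
    qed
    show "?R \<subseteq> ?L"
    proof clarify
      fix i :: nat
      have "((g [^] e) [^] i) [^] m = \<one>"
        by (simp only: nat_pow_pow[OF z(1)] pow_eq_id[OF z(1)] z(2) dvd_triv_right)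
      then show "(g [^] e) [^] i \<in> carrier G \<and> ((g [^] e) [^] i) [^] m = \<one>"
        using z by simp
    qed
  qed
  then show ?thesis
    using ord_inj[OF z(1)] z(2) ez by (simp add: card_image)
qed

lemma (in comm_group) subgroup_roots_of_unity:
  "subgroup {c \<in> carrier G. c [^] (m::nat) = \<one>} G"
  by (rule subgroupI) (auto simp: nat_pow_inv nat_pow_distrib intro: exI[of _ "\<one>"])

text \<open>
  On the cyclic group of $m$-th roots of unity the map $c \mapsto c^e$ has kernel of order
  $d = \gcd(e,m)$ and image the group of $(m/d)$-th roots of unity. Each fibre over the image is
  thus a coset of the group of $d$-th roots of unity.
\<close>
lemma (in comm_group) card_power_eq_root_of_unity:
  fixes e m :: nat
  assumes fin: "finite (carrier G)" and g: "g \<in> carrier G" "ord g = order G"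
    and m: "m dvd order G" and e: "e > 0"
    and u: "u \<in> carrier G" "u [^] (m div gcd e m) = \<one>"
  shows "card {c \<in> carrier G. c [^] m = \<one> \<and> c [^] e = u} = gcd e m"
proof -
  define d where "d = gcd e m"
  have pos: "order G > 0"
    using fin order_gt_0_iff_finite by blast
  obtain r where r: "order G = m * r" using m by blast
  obtain s where s: "m = d * s" unfolding d_def by (meson gcd_dvd2 dvdE)
  obtain t where t: "e = d * t" unfolding d_def by (meson gcd_dvd1 dvdE)
  have nz: "r > 0" "m > 0" "d > 0" "s > 0" using pos r s by auto
  obtain k :: nat where k: "u = g [^] k"
    using generator_powers[OF fin g u(1)] .
  have "u [^] s = \<one>" using u s nz unfolding d_def[symmetric] by simp
  then have "d * s * r dvd k * s"
    using k g r s by (simp add: nat_pow_pow pow_eq_id)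
  then have "d * r dvd k" using nz by (auto simp: mult.assoc mult.left_commute)
  then obtain j where j: "k = d * r * j" by blast
  \<comment> \<open>The hypothesis on \<open>u\<close> makes it the \<open>d\<close>-th power of an \<open>m\<close>-th root of unity \<open>w\<close>.\<close>
  define w where "w = g [^] (r * j)"
  have w: "w \<in> carrier G" "w [^] d = u" "w [^] m = \<one>"
    using g k j r pow_order_eq_1[OF g(1)]
    by (simp_all add: w_def nat_pow_pow pow_eq_id ac_simps)
  \<comment> \<open>Modulo \<open>m\<close> the exponent \<open>d\<close> is a multiple \<open>e * a\<close> of \<open>e\<close>, so \<open>w [^] a\<close> is one solution.\<close>
  obtain a b where ab: "e * a = m * b + d"
    using bezout_nat[of e m] e unfolding d_def by auto
  define c0 where "c0 = w [^] a"
  have c0: "c0 \<in> carrier G" using w by (simp add: c0_def)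
  have c0m: "c0 [^] m = \<one>"
    using w(1,3) by (simp add: c0_def nat_pow_pow pow_eq_id)
  have c0e: "c0 [^] e = u"
  proof -
    have "c0 [^] e = w [^] (e * a)"
      unfolding c0_def using w by (simp only: nat_pow_pow mult.commute)
    also have "\<dots> = (w [^] m) [^] b \<otimes> w [^] d"
      using w(1) by (simp only: ab nat_pow_pow nat_pow_mult)
    finally show ?thesis using w u by simp
  qed
  have "{c \<in> carrier G. c [^] m = \<one> \<and> c [^] e = u} = (\<lambda>x. c0 \<otimes> x) ` {x \<in> carrier G. x [^] d = \<one>}"
    (is "?L = ?R")
  proof
    show "?L \<subseteq> ?R"
    proof
      fix c assume "c \<in> ?L"
      then have c: "c \<in> carrier G" "c [^] m = \<one>" "c [^] e = u" by auto
      define x where "x = inv c0 \<otimes> c"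
      have x: "x \<in> carrier G" "c = c0 \<otimes> x"
        using c c0 by (auto simp: x_def m_assoc[symmetric])
      have "x [^] m = \<one>" "x [^] e = \<one>"
        using c c0 c0m c0e u unfolding x_def
        by (simp_all add: nat_pow_distrib nat_pow_inv)
      then have "x [^] d = \<one>"
        using x by (simp add: pow_eq_id d_def)
      then show "c \<in> ?R" using x by blast
    qed
    show "?R \<subseteq> ?L"
    proof clarify
      fix x assume x: "x \<in> carrier G" "x [^] d = \<one>"
      then have "x [^] m = \<one>" "x [^] e = \<one>"
        by (simp_all add: s t pow_eq_id)
      then show "c0 \<otimes> x \<in> carrier G \<and> (c0 \<otimes> x) [^] m = \<one> \<and> (c0 \<otimes> x) [^] e = u"
        using x c0 c0m c0e u by (simp add: nat_pow_distrib)
    qed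
  qed
  moreover have "inj_on (\<lambda>x. c0 \<otimes> x) {x \<in> carrier G. x [^] d = \<one>}"
    using c0 by (auto intro!: inj_onI)
  moreover have "d dvd order G" using r s by simp
  ultimately show ?thesis
    using card_roots_of_unity[OF fin g] by (simp add: card_image d_def)
qed

text \<open>
  Counting the pairs $(c,x) \in H \times P$ with $Q(cx)$ by $x$ gives $k\,|P|$. Counting them by $c$
  gives $|H|$ times the number of $x \in P$ with $Q(x)$, because each $c \in H$ permutes $P$.
\<close>
lemma (in group) card_translates_double_count:
  assumes H: "subgroup H G" "finite H" and P: "P \<subseteq> carrier G" "finite P"
    and closed: "\<And>c x. c \<in> H \<Longrightarrow> x \<in> P \<Longrightarrow> c \<otimes> x \<in> P"
    and k: "\<And>x. x \<in> P \<Longrightarrow> card {c \<in> H. Q (c \<otimes> x)} = k"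
  shows "card H * card {x \<in> P. Q x} = k * card P"
proof -
  have "card {x \<in> P. Q (c \<otimes> x)} = card {x \<in> P. Q x}" if c: "c \<in> H" for c
  proof -
    have cG: "c \<in> carrier G" and d: "inv c \<in> H"
      using c H subgroup.mem_carrier subgroup.m_inv_closed by fast+
    have cancel: "\<forall>x\<in>{x \<in> P. Q x}. c \<otimes> (inv c \<otimes> x) = x"
      using cG P by (auto simp: m_assoc[symmetric])
    show ?thesis
    proof (rule bij_betw_same_card[where f = "\<lambda>x. c \<otimes> x"],
        rule bij_betw_byWitness[where f' = "\<lambda>x. inv c \<otimes> x"])
      show "\<forall>x\<in>{x \<in> P. Q (c \<otimes> x)}. inv c \<otimes> (c \<otimes> x) = x"
        using cG P by (auto simp: m_assoc[symmetric])
      show "\<forall>x\<in>{x \<in> P. Q x}. c \<otimes> (inv c \<otimes> x) = x"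
        by (rule cancel)
      show "(\<lambda>x. c \<otimes> x) ` {x \<in> P. Q (c \<otimes> x)} \<subseteq> {x \<in> P. Q x}"
        using closed[OF c] by auto
      show "(\<lambda>x. inv c \<otimes> x) ` {x \<in> P. Q x} \<subseteq> {x \<in> P. Q (c \<otimes> x)}"
        using closed[OF d] cancel by auto
    qed
  qed
  then have "card H * card {x \<in> P. Q x} = (\<Sum>c\<in>H. card {x \<in> P. Q (c \<otimes> x)})"
    by simp
  also have "\<dots> = k * card P"
    using k by (intro sum_multicount[OF H(2) P(2)]) blast
  finally show ?thesis .
qed

section \<open>Additivity of the Frobenius map\<close>

lemma (in cring) binomial_theorem:
  assumes x: "x \<in> carrier R" and y: "y \<in> carrier R"
  shows "(x \<oplus> y) [^] n = (\<Oplus>k\<in>{..n}. [(n choose k)] \<cdot>\<^bsub>R\<^esub> (x [^] k \<otimes> y [^] (n - k)))"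
proof (induction n)
  case 0
  then show ?case using x y by simp
next
  case (Suc n)
  define a where "a n k = [(n choose k)] \<cdot>\<^bsub>R\<^esub> (x [^] k \<otimes> y [^] (n - k))" for n k :: nat
  have a: "a n k \<in> carrier R" for n k
    using x y by (simp add: a_def)
  define S where "S = (\<Oplus>k\<in>{..n}. a n k)"
  have S: "S \<in> carrier R" using a by (simp add: S_def)
  have step: "a (Suc n) (Suc k) = x \<otimes> a n k \<oplus> y \<otimes> a n (Suc k)" if "k \<le> n" for k
  proof -
    have 1: "x \<otimes> a n k = [(n choose k)] \<cdot>\<^bsub>R\<^esub> (x [^] Suc k \<otimes> y [^] (n - k))"
      using x y by (simp add: a_def add_pow_rdistr m_ac)
    have 2: "y \<otimes> a n (Suc k) = [(n choose Suc k)] \<cdot>\<^bsub>R\<^esub> (x [^] Suc k \<otimes> y [^] (n - k))"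
    proof (cases "k = n")
      case True
      then show ?thesis using x y by (simp add: a_def binomial_eq_0)
    next
      case False
      then have "n - k = Suc (n - Suc k)" using that by simp
      then show ?thesis
        using x y by (simp add: a_def add_pow_rdistr m_ac)
    qed
    show ?thesis
      unfolding 1 2 using x y by (simp add: a_def add.nat_pow_mult)
  qed
  have zero: "a (Suc n) 0 = y \<otimes> a n 0"
    using x y by (simp add: a_def m_ac)
  have "(\<Oplus>k\<in>{..Suc n}. a (Suc n) k) = (\<Oplus>k\<in>{..n}. a (Suc n) (Suc k)) \<oplus> a (Suc n) 0"
    using a by (subst finsum_Suc2) auto
  also have "(\<Oplus>k\<in>{..n}. a (Suc n) (Suc k)) = (\<Oplus>k\<in>{..n}. x \<otimes> a n k \<oplus> y \<otimes> a n (Suc k))"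
    using a x y step by (intro finsum_cong') auto
  also have "\<dots> = x \<otimes> S \<oplus> y \<otimes> (\<Oplus>k\<in>{..n}. a n (Suc k))"
    using a x y by (simp add: finsum_addf finsum_rdistr S_def Pi_def)
  also have "\<dots> \<oplus> a (Suc n) 0 = x \<otimes> S \<oplus> y \<otimes> ((\<Oplus>k\<in>{..n}. a n (Suc k)) \<oplus> a n 0)"
    using a x y S by (simp add: zero r_distr a_assoc Pi_def)
  also have "(\<Oplus>k\<in>{..n}. a n (Suc k)) \<oplus> a n 0 = (\<Oplus>k\<in>{..Suc n}. a n k)"
    using a by (subst finsum_Suc2) auto
  also have "\<dots> = S"
    using a x y S by (simp add: S_def finsum_Suc Pi_def) (simp add: a_def binomial_eq_0)
  also have "x \<otimes> S \<oplus> y \<otimes> S = (x \<oplus> y) [^] Suc n"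
    using x y S Suc.IH by (simp add: S_def a_def[symmetric] l_distr m_comm)
  finally show ?case by (simp add: a_def)
qed

lemma (in cring) frobenius_add:
  fixes p :: nat
  assumes p: "prime p" and char: "[p] \<cdot>\<^bsub>R\<^esub> \<one> = \<zero>" and x: "x \<in> carrier R" and y: "y \<in> carrier R"
  shows "(x \<oplus> y) [^] p = x [^] p \<oplus> y [^] p"
proof -
  obtain n where n: "p = Suc n" using prime_gt_0_nat[OF p] by (metis gr0_implies_Suc)
  define a where "a k = [(p choose k)] \<cdot>\<^bsub>R\<^esub> (x [^] k \<otimes> y [^] (p - k))" for k :: nat
  have a: "a k \<in> carrier R" for k
    using x y by (simp add: a_def)
  have kill: "[p] \<cdot>\<^bsub>R\<^esub> z = \<zero>" if "z \<in> carrier R" for z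
    using add_pow_ldistr[of \<one> z p] that char by simp
  have mid: "a k = \<zero>" if "0 < k" "k < p" for k
  proof -
    have "p dvd p choose k" using p that by (intro dvd_choose_prime) auto
    then obtain i where "p choose k = p * i" by blast
    then show ?thesis
      using kill[of "x [^] k \<otimes> y [^] (p - k)"] x y
      by (simp add: a_def add.nat_pow_pow[symmetric])
  qed
  have "(x \<oplus> y) [^] p = (\<Oplus>k\<in>{..p}. a k)"
    using binomial_theorem[OF x y, of p] by (simp add: a_def)
  also have "\<dots> = a p \<oplus> (\<Oplus>k\<in>{..n}. a k)"
    using a unfolding n by (subst finsum_Suc) auto
  also have "(\<Oplus>k\<in>{..n}. a k) = (\<Oplus>k\<in>{..n}. if 0 = k then a k else \<zero>)"
    using a mid n by (intro finsum_cong') auto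
  also have "\<dots> = a 0"
    using a by (intro add.finprod_singleton) auto
  finally show ?thesis using x y by (simp add: a_def)
qed

text \<open>
  The order of the additive group kills $1$, which gives $(p \cdot 1)^k = p^k \cdot 1 = 0$.
\<close>
lemma (in domain) char_eq_prime_if_order_power:
  fixes p :: nat
  assumes "order R = p ^ k"
  shows "[p] \<cdot>\<^bsub>R\<^esub> \<one> = \<zero>"
proof -
  have "[(p ^ k)] \<cdot>\<^bsub>R\<^esub> \<one> = \<zero>"
    using add.pow_order_eq_1[of \<one>] assms by (simp add: order_def)
  moreover have "[(p ^ j)] \<cdot>\<^bsub>R\<^esub> \<one> = ([p] \<cdot>\<^bsub>R\<^esub> \<one>) [^] j" for j :: nat
  proof (induction j)
    case (Suc j)
    have "[(p ^ Suc j)] \<cdot>\<^bsub>R\<^esub> \<one> = [(p ^ j)] \<cdot>\<^bsub>R\<^esub> ([p] \<cdot>\<^bsub>R\<^esub> \<one>)"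
      by (simp add: add.nat_pow_pow)
    also have "\<dots> = ([(p ^ j)] \<cdot>\<^bsub>R\<^esub> \<one>) \<otimes> ([p] \<cdot>\<^bsub>R\<^esub> \<one>)"
      using add_pow_ldistr[of \<one> "[p] \<cdot>\<^bsub>R\<^esub> \<one>" "p ^ j"] by simp
    finally show ?case using Suc by simp
  qed simp
  ultimately have "([p] \<cdot>\<^bsub>R\<^esub> \<one>) [^] k = \<zero>" by simp
  then show ?thesis
  proof (induction k)
    case (Suc k)
    then show ?case using integral by fastforce
  qed simp
qed

section \<open>Primitive elements of a finite field\<close>

lemma (in field) mult_of_comm_group: "comm_group (mult_of R)"
  using units_comm_group by (simp add: mult_of_is_Units)

lemma (in field) primitive_element_iff_ord:
  assumes "finite (carrier R)"
  shows "primitive_element R x \<longleftrightarrow>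
    x \<in> carrier (mult_of R) \<and> group.ord (mult_of R) x = order (mult_of R)"
proof -
  interpret G: comm_group "mult_of R" by (rule mult_of_comm_group)
  have "generate (mult_of R) {x} = carrier (mult_of R) \<longleftrightarrow> G.ord x = order (mult_of R)"
    if x: "x \<in> carrier (mult_of R)"
  proof
    assume "generate (mult_of R) {x} = carrier (mult_of R)"
    then show "G.ord x = order (mult_of R)"
      using G.generate_pow_card[OF x] by (simp add: order_def)
  next
    assume "G.ord x = order (mult_of R)"
    moreover have "generate (mult_of R) {x} \<subseteq> carrier (mult_of R)"
      using G.generate_incl x by blast
    ultimately show "generate (mult_of R) {x} = carrier (mult_of R)"
      using G.generate_pow_card[OF x] assms finite_mult_of[OF assms]
      by (intro card_subset_eq) (auto simp: order_def)
  qed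
  then show ?thesis unfolding primitive_element_def by blast
qed

lemma (in field) ex_primitive_element:
  assumes "finite (carrier R)"
  obtains g where "primitive_element R g"
proof -
  interpret G: comm_group "mult_of R" by (rule mult_of_comm_group)
  obtain g where g: "g \<in> carrier (mult_of R)"
      "carrier (mult_of R) = {g [^] i | i::nat. i \<in> UNIV}"
    using finite_field_mult_group_has_gen[OF assms] by blast
  have "generate (mult_of R) {g} = carrier (mult_of R)"
    using G.generate_pow_on_finite_carrier[OF finite_mult_of[OF assms] g(1)] g(2)
    by (simp add: nat_pow_mult_of)
  with g(1) show ?thesis using that unfolding primitive_element_def by blast
qed

lemma (in field) card_primitive_elements:
  assumes "finite (carrier R)"
  shows "card {x \<in> carrier R. primitive_element R x} = totient (order R - 1)"
proof -
  obtain g where "primitive_element R g" using ex_primitive_element[OF assms] .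
  then have ex: "\<exists>a\<in>carrier (mult_of R). group.ord (mult_of R) a = order (mult_of R)"
    using primitive_element_iff_ord[OF assms] by blast
  have "{x \<in> carrier R. primitive_element R x} =
      {a \<in> carrier (mult_of R). group.ord (mult_of R) a = order (mult_of R)}"
    using primitive_element_iff_ord[OF assms] by auto
  then have "card {x \<in> carrier R. primitive_element R x} = phi' (order (mult_of R))"
    using num_elems_of_ord_eq_phi'[OF assms _ ex] by simp
  also have "\<dots> = totient (order (mult_of R))"
    unfolding phi'_def totient_def totatives_def
    by (rule arg_cong[of _ _ card]) auto
  finally show ?thesis by (simp add: order_mult_of[OF assms])
qed

section \<open>Multiples of a primitive element with trace zero\<close>

text \<open>
  The equation $c^{p^2} = c$ says that $c$ lies in the subfield with $p^2$ elements, and $T$ is the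
  trace of $x$ to that subfield. The identity is thus transitivity of the trace together with
  linearity over the subfield.
\<close>
lemma (in field) trace_mult_quadratic_subfield:
  fixes p :: nat
  assumes p: "prime p" and ord: "order R = p ^ 4"
    and c: "c \<in> carrier R" "c [^] (p ^ 2) = c" and x: "x \<in> carrier R"
    and T: "T = x \<oplus> x [^] (p ^ 2)"
  shows "finite_field_trace R p 4 (c \<otimes> x) = c \<otimes> T \<oplus> c [^] p \<otimes> T [^] p"
proof -
  note frob = frobenius_add[OF p char_eq_prime_if_order_power[OF ord]]
  have Tp: "T [^] p = x [^] p \<oplus> x [^] (p ^ 3)"
    using x by (simp add: T frob nat_pow_pow power_numeral_reduce mult.assoc)
  have c3: "c [^] (p ^ 3) = c [^] p"
  proof -
    have "c [^] (p ^ 3) = (c [^] (p ^ 2)) [^] p"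
      using c(1) by (simp add: nat_pow_pow power_numeral_reduce mult.assoc)
    then show ?thesis using c by simp
  qed
  have "finite_field_trace R p 4 (c \<otimes> x) =
      (c \<otimes> x) [^] (p ^ 3) \<oplus> ((c \<otimes> x) [^] (p ^ 2) \<oplus> ((c \<otimes> x) [^] p \<oplus> c \<otimes> x))"
    using c x unfolding finite_field_trace_def
    by (simp add: lessThan_nat_numeral lessThan_Suc add.finprod_insert Pi_def)
  also have "\<dots> = c \<otimes> T \<oplus> c [^] p \<otimes> T [^] p"
    using c x by (simp add: nat_pow_distrib c3 Tp) (simp add: T r_distr a_ac)
  finally show ?thesis .
qed

text \<open>
  If the sum vanished, then $x^{q-1} = -1$, so the order $q^2 - 1$ of $x$ would divide $2(q-1)$,
  which is impossible for $q + 1 > 2$.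
\<close>
lemma (in field) sum_conjugates_nonzero:
  fixes q :: nat
  assumes q: "q \<ge> 2" and ord: "order R = q ^ 2" and x: "primitive_element R x"
  shows "x \<oplus> x [^] q \<noteq> \<zero>"
proof
  have fin: "finite (carrier R)" using ord q by (metis card.infinite order_def power_not_zero not_numeral_le_zero)
  interpret G: comm_group "mult_of R" by (rule mult_of_comm_group)
  have x': "x \<in> carrier (mult_of R)" "G.ord x = (q - 1) * (q + 1)"
    using primitive_element_iff_ord[OF fin] x ord
    by (auto simp: order_mult_of[OF fin] power2_eq_square algebra_simps)
  then have xc: "x \<in> carrier R" "x \<noteq> \<zero>" by auto
  assume "x \<oplus> x [^] q = \<zero>"
  then have "x [^] q = \<ominus> x" using xc by (metis minus_equality nat_pow_closed a_comm)
  moreover have "x [^] q = x \<otimes> x [^] (q - 1)"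
    using q xc by (metis Suc_diff_1 less_le_trans nat_pow_Suc2 pos2)
  ultimately have "x \<otimes> x [^] (q - 1) = x \<otimes> \<ominus> \<one>"
    using xc by (simp add: r_minus)
  then have "x [^] (q - 1) = \<ominus> \<one>"
    using xc m_lcancel by simp
  then have "(x [^] (q - 1)) [^] (2::nat) = \<one>"
    by (simp add: numeral_2_eq_2 l_minus r_minus)
  then have "x [^] ((q - 1) * 2) = \<one>" using xc by (simp add: nat_pow_pow)
  then have "(q - 1) * (q + 1) dvd (q - 1) * 2"
    using G.pow_eq_id[OF x'(1)] x'(2) by (simp add: nat_pow_mult_of)
  moreover have "q - 1 > 0" using q by simp
  ultimately have "q + 1 dvd 2" using nat_mult_dvd_cancel1 by blast
  then show False using q by (auto dest: dvd_imp_le)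
qed

lemma gcd_pred_double_succ:
  fixes p :: nat
  assumes "4 dvd p + 1"
  shows "gcd (p - 1) (2 * (p + 1)) = 2"
proof -
  obtain k where k: "p + 1 = 4 * k" using assms by blast
  then have "k > 0" by (cases k) auto
  then obtain j where j: "p = 4 * j + 3" using k by (cases k) auto
  have "gcd (p - 1) (2 * (p + 1)) = gcd (4 * j + 2) (2 * (4 * j + 2) + 4)"
    by (simp add: j)
  also have "\<dots> = gcd (4 * j + 2) 4"
    by (metis add.commute gcd_add_mult mult.commute)
  also have "\<dots> = gcd 4 (4 * j + 2)" by (simp add: gcd.commute)
  also have "\<dots> = gcd 4 2"
    by (metis gcd_add_mult add.commute mult.commute)
  finally show ?thesis by simp
qed

text \<open>
  For roots of unity $c$ of order dividing $2(p+1)$, trace zero of $cx$ is the equation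
  $c^{p-1} = u$ for a fixed $(p+1)$-th root of unity $u$. The number of solutions is
  $\gcd(p-1, 2(p+1))$, which is $2$ because $p \equiv 3 \pmod 4$. Roots of unity of order dividing
  only $p + 1$ would not do: among them the equation has two solutions or none, depending on
  whether $u$ is a square of such a root.
\<close>
lemma (in field) card_twists_trace_zero:
  fixes p :: nat
  assumes p: "prime p" "4 dvd p + 1" and ord: "order R = p ^ 4" and x: "primitive_element R x"
  shows "card {c \<in> carrier (mult_of R). c [^] (2 * (p + 1)) = \<one> \<and>
    finite_field_trace R p 4 (c \<otimes> x) = \<zero>} = 2"
proof -
  have p2: "p \<ge> 3" using p by (auto dest: dvd_imp_le)
  have fin: "finite (carrier R)"
    using ord p2 by (metis card.infinite order_def power_not_zero not_numeral_le_zero)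
  interpret G: comm_group "mult_of R"
    rewrites "([^]\<^bsub>mult_of R\<^esub>) = (([^]) :: _ \<Rightarrow> nat \<Rightarrow> _)" and "\<one>\<^bsub>mult_of R\<^esub> = \<one>"
    by (rule mult_of_comm_group) (simp_all add: nat_pow_mult_of)
  note frob = frobenius_add[OF p(1) char_eq_prime_if_order_power[OF ord]]
  have gen: "x \<in> carrier (mult_of R)" "group.ord (mult_of R) x = order (mult_of R)"
    using primitive_element_iff_ord[OF fin] x by auto
  then have xc: "x \<in> carrier R" by simp
  have oM: "order (mult_of R) = p ^ 4 - 1" using ord by (simp add: order_mult_of[OF fin])
  define T where "T = x \<oplus> x [^] (p ^ 2)"
  have "2 \<le> p ^ 2" using p2 self_le_power[of p 2] by linarith
  then have T: "T \<in> carrier R" "T \<noteq> \<zero>"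
    using sum_conjugates_nonzero[of "p ^ 2" x] xc x ord
    by (simp_all add: T_def flip: power_mult)
  have x4: "x [^] (p ^ 4) = x"
  proof -
    have "x [^] (p ^ 4) = x [^] (p ^ 4 - 1) \<otimes> x"
      using xc p2 by (metis Suc_diff_1 nat_pow_Suc not_numeral_le_zero neq0_conv zero_less_power)
    then show ?thesis using G.pow_order_eq_1[OF gen(1)] oM xc by simp
  qed
  have Tpp: "(T [^] p) [^] p = T"
  proof -
    have "(T [^] p) [^] p = x [^] (p ^ 2) \<oplus> x [^] (p ^ 4)"
      using xc by (simp add: T_def frob nat_pow_pow power_numeral_reduce mult.assoc)
    then show ?thesis using xc by (simp add: x4 T_def a_comm)
  qed
  \<comment> \<open>For \<open>c\<close> nonzero, \<open>c T + c^p T^p = 0\<close> means \<open>c^(p-1) = u\<close>.\<close>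
  define u where "u = \<ominus> (T \<otimes> inv (T [^] p))"
  have Tp: "T [^] p \<in> carrier R" "T [^] p \<noteq> \<zero>"
    using T G.nat_pow_closed[of T p] by auto
  then have iTp: "inv (T [^] p) \<in> carrier R" "inv (T [^] p) \<otimes> T [^] p = \<one>"
     "inv (T [^] p) \<noteq> \<zero>"
    using field_Units by (auto intro: Units_l_inv)
  have u: "u \<in> carrier R" using T iTp by (simp add: u_def)
  have uTp: "u \<otimes> T [^] p = \<ominus> T"
    using T Tp iTp by (simp add: u_def l_minus m_assoc)
  have u0: "u \<noteq> \<zero>" using uTp T Tp by (metis add.inv_eq_1_iff l_null)
  have up: "u [^] (p + 1) = \<one>"
  proof -
    obtain j where j: "p + 1 = 2 * j" using p by (metis dvd_trans dvdE even_numeral)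
    have neg: "(\<ominus> T) [^] (p + 1) = T [^] (p + 1)"
    proof -
      have "(\<ominus> T) [^] (2::nat) = T [^] (2::nat)"
        using T by (simp add: numeral_2_eq_2 l_minus r_minus)
      then have "((\<ominus> T) [^] (2::nat)) [^] j = (T [^] (2::nat)) [^] j" by simp
      then show ?thesis using T by (simp only: nat_pow_pow j a_inv_closed)
    qed
    have "(T [^] p) [^] (p + 1) = T [^] (p + 1)"
      using T Tp Tpp by (simp add: m_comm)
    then have "u [^] (p + 1) \<otimes> T [^] (p + 1) = \<one> \<otimes> T [^] (p + 1)"
      using arg_cong[OF uTp, of "\<lambda>z. z [^] (p + 1)"] u T Tp neg
      by (simp only: nat_pow_distrib nat_pow_closed l_one)
    moreover have "T [^] (p + 1) \<noteq> \<zero>" using T G.nat_pow_closed[of T "p + 1"] by auto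
    ultimately show ?thesis using u T by (metis m_rcancel nat_pow_closed one_closed)
  qed
  \<comment> \<open>This puts the roots of unity \<open>c\<close> into the subfield with \<open>p ^ 2\<close> elements.\<close>
  have m_dvd: "2 * (p + 1) dvd (p + 1) * (p - 1)"
  proof -
    have "2 dvd p - 1" using p(2) by presburger
    then have "(p + 1) * 2 dvd (p + 1) * (p - 1)" by (rule mult_dvd_mono[OF dvd_refl])
    then show ?thesis by (simp only: mult.commute[of 2])
  qed
  have pp: "(p + 1) * (p - 1) + 1 = p ^ 2" using p2 by (cases p) (auto simp: power2_eq_square)
  have p4: "(p + 1) * (p - 1) * (p ^ 2 + 1) = p ^ 4 - 1"
  proof -
    have "(p ^ 2 - 1) * (p ^ 2 + 1) = p ^ 4 - 1"
      by (simp add: algebra_simps power_add[symmetric] flip: power_mult)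
    then show ?thesis using pp by (metis add_diff_cancel_right')
  qed
  have "finite_field_trace R p 4 (c \<otimes> x) = \<zero> \<longleftrightarrow> c [^] (p - 1) = u"
    if c: "c \<in> carrier (mult_of R)" "c [^] (2 * (p + 1)) = \<one>" for c
  proof -
    have cc: "c \<in> carrier R" "c \<noteq> \<zero>" using c by auto
    have "c [^] ((p + 1) * (p - 1)) = \<one>"
      using c(2) m_dvd G.pow_eq_id[OF c(1)] dvd_trans by blast
    then have "c [^] (p ^ 2) = c"
      using cc unfolding pp[symmetric] by simp
    then have "finite_field_trace R p 4 (c \<otimes> x) = c \<otimes> T \<oplus> c [^] p \<otimes> T [^] p"
      by (intro trace_mult_quadratic_subfield[OF p(1) ord cc(1) _ xc T_def])
    also have "c [^] p = c \<otimes> c [^] (p - 1)"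
      using p2 cc by (metis Suc_diff_1 nat_pow_Suc2 not_numeral_le_zero neq0_conv)
    also have "c \<otimes> T \<oplus> c \<otimes> c [^] (p - 1) \<otimes> T [^] p = c \<otimes> (T \<oplus> c [^] (p - 1) \<otimes> T [^] p)"
      using cc T by (simp add: r_distr m_assoc)
    also have "\<dots> = \<zero> \<longleftrightarrow> T \<oplus> c [^] (p - 1) \<otimes> T [^] p = \<zero>"
      using cc T by (simp add: integral_iff)
    also have "\<dots> \<longleftrightarrow> c [^] (p - 1) \<otimes> T [^] p = u \<otimes> T [^] p"
      unfolding uTp using cc T
      by (metis a_comm minus_equality minus_minus nat_pow_closed m_closed r_neg)
    also have "\<dots> \<longleftrightarrow> c [^] (p - 1) = u"
      using cc u Tp by (simp add: m_rcancel)
    finally show ?thesis .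
  qed
  then have "{c \<in> carrier (mult_of R). c [^] (2 * (p + 1)) = \<one> \<and>
      finite_field_trace R p 4 (c \<otimes> x) = \<zero>} =
    {c \<in> carrier (mult_of R). c [^] (2 * (p + 1)) = \<one> \<and> c [^] (p - 1) = u}"
    by blast
  moreover have "2 * (p + 1) dvd order (mult_of R)"
    unfolding oM p4[symmetric] using m_dvd by (rule dvd_mult2)
  ultimately show ?thesis
    using G.card_power_eq_root_of_unity[OF finite_mult_of[OF fin] gen, of "2 * (p + 1)" "p - 1" u]
      u u0 up p2 gcd_pred_double_succ[OF p(2)] by simp
qed

section \<open>Counting primitive elements of trace zero\<close>

lemma totient_power_of_two_mult:
  assumes "even n"
  shows "totient (2 ^ l * n) = 2 ^ l * totient n"
proof (induction l)
  case (Suc l)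
  have "totient (2 ^ Suc l * n) = totient (2 * (2 ^ l * n))" by (simp add: mult.assoc)
  also have "\<dots> = 2 * totient (2 ^ l * n)" using assms by (simp add: totient_double)
  finally show ?case using Suc by simp
qed simp

theorem corollary1p10:
  fixes F :: "('a, 'b) ring_scheme" and p :: nat
  assumes "mersenne_prime p"
    and "field F"
    and "order F = p ^ 4"
  shows "real (card {\<xi> \<in> carrier F. primitive_element F \<xi> \<and> finite_field_trace F p 4 \<xi> = \<zero>\<^bsub>F\<^esub>}) =
    1 / real p * (real (totient (p ^ 4 - 1)) - real (totient ((p ^ 4 - 1) div (p + 1))))"
proof -
  interpret field F by fact
  obtain l where l: "prime l" "p = 2 ^ l - 1" and p: "prime p"
    using assms(1) unfolding mersenne_prime_def by blast
  have p1: "p + 1 = 2 ^ l" using l by simp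
  have "l \<ge> 2" using l(1) prime_ge_2_nat by blast
  then have four: "4 dvd p + 1" unfolding p1 using le_imp_power_dvd[of 2 l "2::nat"] by simp
  then have p3: "p \<ge> 3" by (auto dest: dvd_imp_le)
  have fin: "finite (carrier F)"
    using assms(3) p3 by (metis card.infinite order_def power_not_zero not_numeral_le_zero)
  define m where "m = 2 * (p + 1)"
  have m2: "m = 2 ^ Suc l" unfolding m_def p1 by simp
  have "odd p" using four by presburger
  then obtain j where j: "p = 2 * j + 1" by (elim oddE)
  define r where "r = j * (p ^ 2 + 1)"
  have n: "p ^ 4 - 1 = m * r"
    unfolding m_def r_def j
    by (simp add: algebra_simps power2_eq_square power4_eq_xxxx)
  have ev: "even r" using \<open>odd p\<close> by (simp add: r_def)
  have "j > 0" using j p3 by auto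
  then have r0: "r > 0" by (simp add: r_def)
  interpret G: comm_group "mult_of F"
    rewrites "([^]\<^bsub>mult_of F\<^esub>) = (([^]\<^bsub>F\<^esub>) :: _ \<Rightarrow> nat \<Rightarrow> _)" and "\<one>\<^bsub>mult_of F\<^esub> = \<one>\<^bsub>F\<^esub>"
      and "(\<otimes>\<^bsub>mult_of F\<^esub>) = (\<otimes>\<^bsub>F\<^esub>)"
    by (rule mult_of_comm_group) (simp_all add: nat_pow_mult_of)
  have oM: "order (mult_of F) = m * r" using assms(3) n by (simp add: order_mult_of[OF fin])
  \<comment> \<open>Odd primes do not divide the power of two \<open>m\<close>, and \<open>2\<close> divides \<open>r\<close>.\<close>
  have primes: "q dvd r" if "prime q" "q dvd m * r" for q
  proof (cases "q dvd r")
    case False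
    then have "q dvd 2 ^ Suc l" using that unfolding m2 by (metis prime_dvd_multD)
    then have "q = 2" using that(1) by (metis prime_dvd_power_nat primes_dvd_imp_eq two_is_prime_nat)
    then show ?thesis using ev by simp
  qed
  define P where "P = {x \<in> carrier F. primitive_element F x}"
  define C where "C = {c \<in> carrier (mult_of F). c [^]\<^bsub>F\<^esub> m = \<one>\<^bsub>F\<^esub>}"
  define N where "N = {x \<in> P. finite_field_trace F p 4 x = \<zero>\<^bsub>F\<^esub>}"
  have finP: "finite P" and finC: "finite C" using fin by (auto simp: P_def C_def)
  obtain g where "primitive_element F g" using ex_primitive_element[OF fin] .
  then have cardC: "card C = m"
    using G.card_roots_of_unity[OF finite_mult_of[OF fin], of g m] oM
    by (simp add: C_def primitive_element_iff_ord[OF fin])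
  have CP: "c \<otimes>\<^bsub>F\<^esub> x \<in> P" if c: "c \<in> C" and x: "x \<in> P" for c x
  proof -
    have x': "x \<in> carrier (mult_of F)" "G.ord x = order (mult_of F)"
      using x by (auto simp: P_def primitive_element_iff_ord[OF fin])
    have c': "c \<in> carrier (mult_of F)" "c [^]\<^bsub>F\<^esub> m = \<one>\<^bsub>F\<^esub>"
      using c by (auto simp: C_def)
    have "order (mult_of F) div m = r" using m2 by (simp add: oM)
    then have "G.ord (c \<otimes>\<^bsub>F\<^esub> x) = order (mult_of F)"
      using G.generator_mult_root_of_unity[OF finite_mult_of[OF fin] x' c'] primes oM
      by (metis dvd_triv_left)
    moreover have "c \<otimes>\<^bsub>F\<^esub> x \<in> carrier (mult_of F)"
      using x' c' by (intro G.m_closed)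
    ultimately show ?thesis
      by (simp add: P_def primitive_element_iff_ord[OF fin])
  qed
  have "card C * card N = 2 * card P"
    unfolding N_def
  proof (rule G.card_translates_double_count)
    show "subgroup C (mult_of F)"
      unfolding C_def by (rule G.subgroup_roots_of_unity)
    show "P \<subseteq> carrier (mult_of F)"
      by (auto simp: P_def primitive_element_def)
  next
    fix x assume "x \<in> P"
    then show "card {c \<in> C. finite_field_trace F p 4 (c \<otimes>\<^bsub>F\<^esub> x) = \<zero>\<^bsub>F\<^esub>} = 2"
      using card_twists_trace_zero[OF p four assms(3), of x]
      by (simp add: C_def P_def m_def conj_assoc)
  qed (use finC finP CP in auto)
  moreover have "card P = totient (p ^ 4 - 1)"
    using card_primitive_elements[OF fin] assms(3) by (simp add: P_def)
  ultimately have *: "totient (p ^ 4 - 1) = (p + 1) * card N" by (simp add: m_def cardC)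
  have n2: "p ^ 4 - 1 = 2 ^ l * (2 * r)" unfolding n m2 by simp
  then have quot: "(p ^ 4 - 1) div (p + 1) = 2 * r" unfolding p1 by simp
  have "totient (p ^ 4 - 1) = (p + 1) * totient (2 * r)"
    unfolding n2 using totient_power_of_two_mult[of "2 * r" l] p1 by simp
  with * have "(p + 1) * totient (2 * r) = (p + 1) * card N" by metis
  then have "totient ((p ^ 4 - 1) div (p + 1)) = card N"
    unfolding quot using nat_mult_eq_cancel1[of "p + 1"] by simp
  then have "real (card N) =
    1 / real p * (real (totient (p ^ 4 - 1)) - real (totient ((p ^ 4 - 1) div (p + 1))))"
    using * p3 by (simp add: field_simps)
  then show ?thesis by (simp add: N_def P_def conj_assoc)
qed

end
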